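(* Let $0<a<1$ be real, let $b\geq 100$ be real, let $K>0$ be an integer, and let $R=\exp(2K\pi/b)$ be such that $1\leq R<\pi$. Then $$\int_0^R f(t,a)\sin(b\log t)\,dt=-\sum_{n=0}^\infty \frac{g^{(n)}(0)\,b}{n!\,((n+a)^2+b^2)}R^{n+a}.$$
   Context: For real $t>0$ and real $a$, $f(t,a):=\dfrac{t^{a-1}}{e^t+1}$. For real $t$, $g(t):=\dfrac{1}{e^t+1}$, and $g^{(n)}(0)$ denotes its $n$-th derivative at $0$ (with $g^{(0)}=g$). *)

theory Defs
  imports "HOL-Analysis.Analysis"
begin

definition g_fun :: "real \<Rightarrow> real" where
  "g_fun t = 1 / (exp t + 1)"

(* Only meant for t > 0; at t \<le> 0 its value is an artefact of powr. *)
definition f_fun :: "real \<Rightarrow> real \<Rightarrow> real" where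
  "f_fun t a = t powr (a - 1) / (exp t + 1)"

end

theory Submission
  imports Defs "HOL-Complex_Analysis.Cauchy_Integral_Formula"
begin

text \<open>
  Substituting \<open>t = exp u\<close> turns \<open>t powr (s - 1) * sin (b * ln t)\<close> into
  \<open>exp (s * u) * sin (b * u)\<close>, which has an elementary antiderivative. At the upper
  endpoint \<open>u = ln R = 2 * K * pi / b\<close> the phase \<open>b * u\<close> is a multiple of the full
  period, so only the cosine part of that antiderivative survives, and it contributes
  \<open>- b * R powr s / (s\<^sup>2 + b\<^sup>2)\<close>.  The statement is the sum of these contributions with
  \<open>s = n + a\<close>, weighted by the Taylor coefficients of \<open>g_fun\<close> at \<open>0\<close>.

  The Taylor series represents \<open>g_fun\<close> on the whole range of integration because the complex
  function \<open>1 / (exp z + 1)\<close> has its nearest poles at \<open>\<plusminus> \<i> * pi\<close> and \<open>R < pi\<close>.  The series may be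
  integrated termwise because it converges absolutely even at the endpoint \<open>R\<close>, and because
  the weight \<open>t powr (a - 1)\<close> is integrable at \<open>0\<close>
  (\<open>sine_moment_of_power_series\<close>, of which the statement is an instance).
\<close>

section \<open>Sine moments of powers\<close>

lemma has_integral_greaterThanAtMost_iff:
  fixes f :: "real \<Rightarrow> 'a::banach"
  shows "(f has_integral I) {l<..u} \<longleftrightarrow> (f has_integral I) {l..u}"
proof (rule has_integral_spike_set_eq)
  show "negligible {x \<in> {l<..u} - {l..u}. f x \<noteq> 0}"
    by (rule negligible_subset[of "{l}"]) auto
  show "negligible {x \<in> {l..u} - {l<..u}. f x \<noteq> 0}"
    by (rule negligible_subset[of "{l}"]) auto
qed

lemma set_integrable_powr_from_0:
  fixes s R :: real
  assumes "s > 0" "R > 0"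
  shows "set_integrable lborel {0<..R} (\<lambda>t. t powr (s - 1))"
    and "(LBINT t:{0<..R}. t powr (s - 1)) = R powr s / s"
proof -
  have "((\<lambda>t. t powr (s - 1)) has_integral R powr s / s) {0..R}"
    using has_integral_powr_from_0[of "s - 1" R] assms by simp
  then have I: "((\<lambda>t. t powr (s - 1)) has_integral R powr s / s) {0<..R}"
    by (simp only: has_integral_greaterThanAtMost_iff)
  then have "set_integrable lebesgue {0<..R} (\<lambda>t. t powr (s - 1))"
    by (intro nonnegative_absolutely_integrable_1) auto
  then show *: "set_integrable lborel {0<..R} (\<lambda>t. t powr (s - 1))"
    unfolding set_integrable_def by (subst (asm) integrable_completion) auto
  show "(LBINT t:{0<..R}. t powr (s - 1)) = R powr s / s"
    using set_borel_integral_eq_integral(2)[OF *] integral_unique[OF I] by simp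
qed

text \<open>
  The antiderivative \<open>F\<close> below is \<open>exp (s * u) * (s * sin (b * u) - b * cos (b * u)) / (s\<^sup>2 + b\<^sup>2)\<close>
  at \<open>u = ln t\<close>; it is continuous up to \<open>t = 0\<close>, where it vanishes.
\<close>
lemma sine_moment_of_powr:
  fixes s b R :: real
  assumes "s > 0" "R > 0"
  shows "set_integrable lborel {0<..R} (\<lambda>t. t powr (s - 1) * sin (b * ln t))"
    and "(LBINT t:{0<..R}. t powr (s - 1) * sin (b * ln t))
           = R powr s * (s * sin (b * ln R) - b * cos (b * ln R)) / (s\<^sup>2 + b\<^sup>2)"
proof -
  show int: "set_integrable lborel {0<..R} (\<lambda>t. t powr (s - 1) * sin (b * ln t))"
    by (rule set_integrable_bound[OF set_integrable_powr_from_0(1)[OF assms]])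
       (auto simp: set_borel_measurable_def abs_mult intro!: mult_left_le)
  define F where
    "F = (\<lambda>t. t powr s * ((s * sin (b * ln t) - b * cos (b * ln t)) / (s\<^sup>2 + b\<^sup>2)))"
  have pos: "s\<^sup>2 + b\<^sup>2 > 0"
    using assms by (simp add: add_pos_nonneg)
  \<comment> \<open>The oscillating factor need not have a limit at \<open>0\<close>, but it is bounded and \<open>t powr s\<close> tends to \<open>0\<close>.\<close>
  have bound: "\<bar>(s * sin (b * ln t) - b * cos (b * ln t)) / (s\<^sup>2 + b\<^sup>2)\<bar>
                 \<le> (\<bar>s\<bar> + \<bar>b\<bar>) / (s\<^sup>2 + b\<^sup>2)" for t
  proof -
    have "\<bar>s * sin (b * ln t)\<bar> \<le> \<bar>s\<bar>" "\<bar>b * cos (b * ln t)\<bar> \<le> \<bar>b\<bar>"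
      by (auto simp: abs_mult intro!: mult_left_le)
    then have "\<bar>s * sin (b * ln t) - b * cos (b * ln t)\<bar> \<le> \<bar>s\<bar> + \<bar>b\<bar>"
      by linarith
    then show ?thesis
      using pos by (simp add: abs_divide divide_right_mono)
  qed
  have "((\<lambda>t. t powr s) \<longlongrightarrow> 0) (at 0 within {0..R})"
  proof -
    have "continuous_on {0..R} (\<lambda>t. t powr s)"
      using assms by (intro continuous_on_powr') auto
    then show ?thesis
      using assms by (auto simp: continuous_on_def dest!: bspec[of _ _ 0])
  qed
  then have "(F \<longlongrightarrow> 0) (at 0 within {0..R})"
    unfolding F_def by (rule lim_null_mult_right_bounded) (use bound in \<open>auto intro!: always_eventually\<close>)
  then have "continuous (at 0 within {0..R}) F"
    by (simp add: continuous_within F_def)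
  moreover have "continuous (at t within {0..R}) F" if "t \<in> {0<..R}" for t
    unfolding F_def using that pos by (intro continuous_intros) auto
  ultimately have "continuous (at t within {0..R}) F" if "t \<in> {0..R}" for t
    using that by (cases "t = 0") auto
  then have cont: "continuous_on {0..R} F"
    unfolding continuous_on_eq_continuous_within by blast
  have deriv: "(F has_vector_derivative t powr (s - 1) * sin (b * ln t)) (at t)"
    if "t \<in> {0<..<R}" for t
  proof -
    let ?S = "sin (b * ln t)" and ?C = "cos (b * ln t)"
    have t: "t > 0"
      using that by simp
    have cancel: "s * P * ((s * S - b * C) / D) + P * t * ((s * (C * (b / t)) + b * (S * (b / t))) / D)
        = P * S * ((s\<^sup>2 + b\<^sup>2) / D)" for P S C D :: real
      using t by (cases "D = 0") (auto simp: field_simps power2_eq_square)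
    have "((\<lambda>t. s * sin (b * ln t) - b * cos (b * ln t)) has_real_derivative
             s * (?C * (b / t)) + b * (?S * (b / t))) (at t)"
      using t by (auto intro!: derivative_eq_intros simp: mult_ac)
    then have "((\<lambda>t. (s * sin (b * ln t) - b * cos (b * ln t)) / (s\<^sup>2 + b\<^sup>2)) has_real_derivative
             (s * (?C * (b / t)) + b * (?S * (b / t))) / (s\<^sup>2 + b\<^sup>2)) (at t)"
      by (rule DERIV_cdivide)
    from DERIV_mult[OF has_real_derivative_powr[OF t, of s] this]
    have "(F has_real_derivative
             s * t powr (s - 1) * ((s * ?S - b * ?C) / (s\<^sup>2 + b\<^sup>2))
             + t powr s * ((s * (?C * (b / t)) + b * (?S * (b / t))) / (s\<^sup>2 + b\<^sup>2))) (at t)"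
      unfolding F_def by (simp only: mult.commute[of "t powr s"])
    also have "t powr s = t powr (s - 1) * t"
      using t by (simp add: powr_diff)
    also have "s * t powr (s - 1) * ((s * ?S - b * ?C) / (s\<^sup>2 + b\<^sup>2))
             + t powr (s - 1) * t * ((s * (?C * (b / t)) + b * (?S * (b / t))) / (s\<^sup>2 + b\<^sup>2))
        = t powr (s - 1) * ?S * ((s\<^sup>2 + b\<^sup>2) / (s\<^sup>2 + b\<^sup>2))"
      by (rule cancel)
    also have "\<dots> = t powr (s - 1) * ?S"
      using pos by simp
    finally show ?thesis
      by (simp add: has_real_derivative_iff_has_vector_derivative)
  qed
  have "((\<lambda>t. t powr (s - 1) * sin (b * ln t)) has_integral F R - F 0) {0..R}"
    using assms by (intro fundamental_theorem_of_calculus_interior cont deriv) auto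
  then have "((\<lambda>t. t powr (s - 1) * sin (b * ln t)) has_integral F R) {0<..R}"
    by (simp add: has_integral_greaterThanAtMost_iff F_def)
  then show "(LBINT t:{0<..R}. t powr (s - 1) * sin (b * ln t))
           = R powr s * (s * sin (b * ln R) - b * cos (b * ln R)) / (s\<^sup>2 + b\<^sup>2)"
    using set_borel_integral_eq_integral(2)[OF int] by (simp add: integral_unique F_def)
qed

section \<open>Termwise integration of a power series\<close>

text \<open>
  Termwise integration is justified by dominated convergence: the \<open>n\<close>-th term is bounded
  by \<open>\<bar>c n\<bar> * t powr (real n + a - 1)\<close>, whose integral is
  \<open>\<bar>c n\<bar> * R powr (real n + a) / (real n + a) \<le> \<bar>c n\<bar> * R ^ n * (R powr a / a)\<close>, a summable bound.
\<close>
lemma sine_moment_of_power_series: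
  fixes a b R :: real and c :: "nat \<Rightarrow> real"
  assumes "a > 0" "R > 0" and summ: "summable (\<lambda>n. \<bar>c n\<bar> * R ^ n)"
  shows "set_integrable lborel {0<..R} (\<lambda>t. t powr (a - 1) * (\<Sum>n. c n * t ^ n) * sin (b * ln t))"
    and "(\<lambda>n. c n * (R powr (real n + a) * ((real n + a) * sin (b * ln R) - b * cos (b * ln R))
                / ((real n + a)\<^sup>2 + b\<^sup>2)))
         sums (LBINT t:{0<..R}. t powr (a - 1) * (\<Sum>n. c n * t ^ n) * sin (b * ln t))"
proof -
  define f where
    "f = (\<lambda>n t. indicator {0<..R} t *\<^sub>R (c n * (t powr (real n + a - 1) * sin (b * ln t))))"
  have int: "integrable lborel (f n)" for n
    using sine_moment_of_powr(1)[of "real n + a" R b] assms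
    unfolding f_def set_integrable_def[symmetric] by (intro set_integrable_mult_right) auto
  have integral: "integral\<^sup>L lborel (f n) =
      c n * (R powr (real n + a) * ((real n + a) * sin (b * ln R) - b * cos (b * ln R))
                / ((real n + a)\<^sup>2 + b\<^sup>2))" for n
    using sine_moment_of_powr(2)[of "real n + a" R b] assms
    unfolding f_def set_lebesgue_integral_def[symmetric] by simp
  have powr_split: "t powr (real n + a - 1) = t powr (a - 1) * t ^ n" if "t > 0" for t n
    using that by (simp add: powr_add powr_realpow powr_diff)
  have pointwise: "summable (\<lambda>n. \<bar>c n * t ^ n\<bar>)" if "t \<in> {0<..R}" for t
    by (rule summable_comparison_test'[OF summ, of 0])
       (use that in \<open>auto simp: abs_mult power_abs intro!: mult_left_mono power_mono\<close>)
  have norm_f: "norm (f n t) \<le> indicator {0<..R} t * (t powr (a - 1) * \<bar>c n * t ^ n\<bar>)" for n t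
  proof (cases "t \<in> {0<..R}")
    case True
    have "\<bar>t powr (a - 1) * (c n * t ^ n) * sin (b * ln t)\<bar> \<le> \<bar>t powr (a - 1) * (c n * t ^ n)\<bar>"
      unfolding abs_mult[of _ "sin _"] by (intro mult_left_le) auto
    with True show ?thesis
      by (simp add: f_def powr_split abs_mult mult_ac)
  qed (simp add: f_def)
  have "summable (\<lambda>n. norm (f n t))" for t
  proof (cases "t \<in> {0<..R}")
    case True
    then show ?thesis
      using norm_f[of _ t]
      by (intro summable_comparison_test'[OF summable_mult[OF pointwise, of t "t powr (a - 1)"], of 0])
         auto
  qed (simp add: f_def)
  then have AE: "AE t in lborel. summable (\<lambda>n. norm (f n t))"
    by simp
  have norms: "summable (\<lambda>n. \<integral>t. norm (f n t) \<partial>lborel)"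
  proof (rule summable_comparison_test'[OF summable_mult2[OF summ, of "R powr a / a"], of 0])
    fix n :: nat
    have s: "real n + a > 0"
      using assms by simp
    note P = set_integrable_powr_from_0[OF s \<open>R > 0\<close>]
    have "(\<integral>t. norm (f n t) \<partial>lborel) \<le> (LBINT t:{0<..R}. \<bar>c n\<bar> * t powr (real n + a - 1))"
      unfolding set_lebesgue_integral_def
    proof (rule integral_mono)
      show "integrable lborel (\<lambda>t. indicator {0<..R} t *\<^sub>R (\<bar>c n\<bar> * t powr (real n + a - 1)))"
        unfolding set_integrable_def[symmetric] by (intro set_integrable_mult_right P(1))
    next
      fix t :: real
      show "norm (f n t) \<le> indicator {0<..R} t *\<^sub>R (\<bar>c n\<bar> * t powr (real n + a - 1))"
        using norm_f[of n t] by (cases "t \<in> {0<..R}") (auto simp: powr_split abs_mult mult_ac)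
    qed (use int in auto)
    also have "\<dots> = \<bar>c n\<bar> * (R powr (real n + a) / (real n + a))"
      using P(2) by simp
    also have "R powr (real n + a) / (real n + a) \<le> R powr (real n + a) / a"
      using assms by (intro divide_left_mono) auto
    also have "\<bar>c n\<bar> * (R powr (real n + a) / a) = \<bar>c n\<bar> * R ^ n * (R powr a / a)"
      using assms by (simp add: powr_add powr_realpow)
    finally show "norm (\<integral>t. norm (f n t) \<partial>lborel) \<le> \<bar>c n\<bar> * R ^ n * (R powr a / a)"
      by (simp add: mult_left_mono)
  qed
  have sum_f: "(\<lambda>t. \<Sum>n. f n t) =
      (\<lambda>t. indicator {0<..R} t *\<^sub>R (t powr (a - 1) * (\<Sum>n. c n * t ^ n) * sin (b * ln t)))"
  proof
    fix t
    show "(\<Sum>n. f n t) =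
      indicator {0<..R} t *\<^sub>R (t powr (a - 1) * (\<Sum>n. c n * t ^ n) * sin (b * ln t))"
    proof (cases "t \<in> {0<..R}")
      case True
      have "summable (\<lambda>n. c n * t ^ n)"
        using pointwise[OF True] by (rule summable_rabs_cancel)
      then have "(\<lambda>n. t powr (a - 1) * (c n * t ^ n) * sin (b * ln t)) sums
              (t powr (a - 1) * (\<Sum>n. c n * t ^ n) * sin (b * ln t))"
        by (intro sums_mult sums_mult2 summable_sums)
      moreover have "(\<lambda>n. f n t) = (\<lambda>n. t powr (a - 1) * (c n * t ^ n) * sin (b * ln t))"
        using True by (simp add: f_def powr_split mult_ac)
      ultimately show ?thesis
        using True by (simp add: sums_iff)
    qed (simp add: f_def)
  qed
  show "set_integrable lborel {0<..R} (\<lambda>t. t powr (a - 1) * (\<Sum>n. c n * t ^ n) * sin (b * ln t))"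
    using integrable_suminf[OF int AE norms] by (simp only: sum_f set_integrable_def)
  show "(\<lambda>n. c n * (R powr (real n + a) * ((real n + a) * sin (b * ln R) - b * cos (b * ln R))
                / ((real n + a)\<^sup>2 + b\<^sup>2)))
         sums (LBINT t:{0<..R}. t powr (a - 1) * (\<Sum>n. c n * t ^ n) * sin (b * ln t))"
    using sums_integral[OF int AE norms]
    by (simp only: sum_f integral set_lebesgue_integral_def)
qed

section \<open>Taylor series of the logistic function\<close>

text \<open>
  The series of \<open>holomorphic_power_series\<close> has complex derivatives as coefficients, whereas the
  series sought has derivatives of a real function; along the real line the two agree.
\<close>
lemma higher_deriv_of_real_part:
  fixes f :: "complex \<Rightarrow> complex" and g :: "real \<Rightarrow> real"
  assumes hol: "f holomorphic_on S" and "open S" and "range of_real \<subseteq> S"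
    and eq: "\<And>x. g x = Re (f (of_real x))"
  shows "(deriv ^^ n) g x = Re ((deriv ^^ n) f (of_real x))"
proof (induction n arbitrary: x)
  case (Suc n)
  have "((deriv ^^ n) f has_field_derivative (deriv ^^ Suc n) f (of_real x)) (at (of_real x))"
    using assms by (intro has_field_derivative_higher_deriv[OF hol]) auto
  then have "((\<lambda>y. Re ((deriv ^^ n) f (of_real y))) has_real_derivative
          Re ((deriv ^^ Suc n) f (of_real x))) (at x)"
    by (intro has_field_derivative_Re has_vector_derivative_real_field)
  moreover have "(deriv ^^ n) g = (\<lambda>y. Re ((deriv ^^ n) f (of_real y)))"
    using Suc.IH by blast
  ultimately show ?case
    by (simp add: DERIV_imp_deriv)
qed (simp add: eq)

text \<open>
  The horizontal strip between the poles \<open>\<plusminus> \<i> * pi\<close> contains both the real line, on which real and complex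
  derivatives are compared, and the disc of radius \<open>pi\<close>, on which the Taylor series converges.
\<close>
lemma holomorphic_logistic:
  "(\<lambda>z. 1 / (exp z + 1)) holomorphic_on {z. \<bar>Im z\<bar> < pi}"
proof (intro holomorphic_intros)
  fix z assume z: "z \<in> {z. \<bar>Im z\<bar> < pi}"
  show "exp z + 1 \<noteq> 0"
  proof
    assume "exp z + 1 = 0"
    then have "exp z = exp (\<i> * of_real pi)"
      by (simp add: exp_pi_i eq_neg_iff_add_eq_0)
    then obtain n :: int where "z = \<i> * of_real pi + (of_int (2 * n) * pi) * \<i>"
      unfolding exp_eq by blast
    then have Im: "Im z = pi * of_int (2 * n + 1)"
      by (simp add: algebra_simps)
    have "1 \<le> \<bar>2 * n + 1\<bar>"
      by presburger
    then have "pi * 1 \<le> pi * of_int \<bar>2 * n + 1\<bar>"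
      by (intro mult_left_mono) auto
    also have "\<dots> = \<bar>Im z\<bar>"
      unfolding Im by (simp add: abs_mult)
    finally show False
      using z by simp
  qed
qed

lemma g_fun_Taylor_series:
  assumes "\<bar>t\<bar> < pi"
  shows "(\<lambda>n. (deriv ^^ n) g_fun 0 / fact n * t ^ n) sums g_fun t"
proof -
  define G :: "complex \<Rightarrow> complex" where "G = (\<lambda>z. 1 / (exp z + 1))"
  define S where "S = {z. \<bar>Im z\<bar> < pi}"
  have hol: "G holomorphic_on S"
    unfolding G_def S_def by (rule holomorphic_logistic)
  have S: "open S" "range of_real \<subseteq> S"
    unfolding S_def by (auto intro!: open_Collect_less continuous_intros)
  have G_real: "G (of_real x) = of_real (g_fun x)" for x
    by (simp add: G_def g_fun_def exp_of_real)
  have deriv: "(deriv ^^ n) g_fun 0 = Re ((deriv ^^ n) G 0)" for n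
    using higher_deriv_of_real_part[OF hol S, of g_fun n 0] by (simp add: G_real)
  have "ball 0 pi \<subseteq> S"
    unfolding S_def by (auto intro: le_less_trans[OF abs_Im_le_cmod])
  then have "(\<lambda>n. (deriv ^^ n) G 0 / fact n * (of_real t - 0) ^ n) sums G (of_real t)"
    using assms by (intro holomorphic_power_series[of G 0 pi] holomorphic_on_subset[OF hol]) auto
  then have "(\<lambda>n. Re ((deriv ^^ n) G 0 / fact n * (of_real t - 0) ^ n)) sums Re (G (of_real t))"
    by (rule sums_Re)
  moreover have "Re ((deriv ^^ n) G 0 / fact n * (of_real t - 0) ^ n)
                   = (deriv ^^ n) g_fun 0 / fact n * t ^ n" for n
  proof -
    have "(deriv ^^ n) G 0 / fact n * (of_real t - 0) ^ n = (t ^ n / fact n) *\<^sub>R (deriv ^^ n) G 0"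
      by (simp add: scaleR_conv_of_real)
    then show ?thesis
      by (simp only: deriv scaleR_complex.sel) simp
  qed
  ultimately show ?thesis
    by (simp add: G_real)
qed

theorem theorem2:
  fixes a b R :: real and K :: int
  assumes "0 < a" and "a < 1"
    and "b \<ge> 100"
    and "K > 0"
    and "R = exp (2 * of_int K * pi / b)"
    and "1 \<le> R" and "R < pi"
  shows "set_integrable lborel {0<..R} (\<lambda>t. f_fun t a * sin (b * ln t))
    \<and> summable (\<lambda>n. (deriv ^^ n) g_fun 0 * b / (fact n * ((real n + a)\<^sup>2 + b\<^sup>2)) * R powr (real n + a))
    \<and> (LBINT t:{0<..R}. f_fun t a * sin (b * ln t))
      = - (\<Sum>n. (deriv ^^ n) g_fun 0 * b / (fact n * ((real n + a)\<^sup>2 + b\<^sup>2)) * R powr (real n + a))"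
proof -
  define c where "c = (\<lambda>n. (deriv ^^ n) g_fun 0 / fact n)"
  define h where "h = (\<lambda>t. t powr (a - 1) * (\<Sum>n. c n * t ^ n) * sin (b * ln t))"
  have R: "R > 0"
    using assms by simp
  \<comment> \<open>Absolute convergence at \<open>R\<close>: the series still converges at a point beyond \<open>R\<close>.\<close>
  obtain r where r: "R < r" "r < pi"
    using dense[OF \<open>R < pi\<close>] by blast
  have "summable (\<lambda>n. c n * r ^ n)"
    using g_fun_Taylor_series[of r] r R by (simp add: c_def sums_iff)
  then have "summable (\<lambda>n. norm (c n * R ^ n))"
    by (rule powser_insidea) (use r R in auto)
  then have summ: "summable (\<lambda>n. \<bar>c n\<bar> * R ^ n)"
    using R by (simp add: abs_mult power_abs)
  note moment = sine_moment_of_power_series[OF \<open>0 < a\<close> R summ, of b, folded h_def]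
  have h: "f_fun t a * sin (b * ln t) = h t" if "t \<in> {0<..R}" for t
    using g_fun_Taylor_series[of t] that \<open>R < pi\<close>
    by (simp add: h_def f_fun_def g_fun_def c_def sums_iff)
  have phase: "b * ln R = 2 * of_int K * pi"
    using assms by simp
  have "sin (b * ln R) = 0" "cos (b * ln R) = 1"
    unfolding phase using sin_int_2pin[of K] cos_int_2pin[of K] by (simp_all add: mult_ac)
  then have term_eq: "c n * (R powr (real n + a) * ((real n + a) * sin (b * ln R) - b * cos (b * ln R))
                / ((real n + a)\<^sup>2 + b\<^sup>2))
      = - ((deriv ^^ n) g_fun 0 * b / (fact n * ((real n + a)\<^sup>2 + b\<^sup>2)) * R powr (real n + a))" for n
    by (simp add: c_def)
  have sums: "(\<lambda>n. (deriv ^^ n) g_fun 0 * b / (fact n * ((real n + a)\<^sup>2 + b\<^sup>2)) * R powr (real n + a))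
          sums - (LBINT t:{0<..R}. h t)"
    using sums_minus[OF moment(2)] by (simp only: term_eq minus_minus)
  have "set_integrable lborel {0<..R} (\<lambda>t. f_fun t a * sin (b * ln t))"
    using moment(1) by (subst set_integrable_cong[OF refl refl h]) auto
  moreover have "(LBINT t:{0<..R}. f_fun t a * sin (b * ln t)) = (LBINT t:{0<..R}. h t)"
    by (rule set_lebesgue_integral_cong) (auto simp: h)
  ultimately show ?thesis
    using sums by (simp add: sums_iff)
qed

end
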